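(* Every strongly effectively simple set $A$ has hard instances, even with respect to $\overline{ic}$; that is, for every strongly effectively simple set $A$ there is a constant $c$ such that $ic(x:A) \geq C(x) - c$ for infinitely many $x$, and there is a constant $c'$ such that $\overline{ic}(x:A) \geq C(x) - c'$ for infinitely many $x$.
   Context: $\mathbb{N}$ is identified with $\{0,1\}^*$ via the canonical (length-lexicographic) bijection, so sets may be viewed as subsets of either. $\{W_e\}_{e\in\mathbb{N}}$ is the standard enumeration of all r.e. sets, and $\overline{A}$ is the complement of $A$. A set $A$ is strongly effectively simple if it is a coinfinite r.e. set and there is a total recursive function $f$ such that for all $e$: if $W_e \subseteq \overline{A}$ then $\max(W_e) < f(e)$ (i.e., every element of $W_e$ is less than $f(e)$). $\lambda$ is the empty string, $l(p)$ is the length of $p \in \{0,1\}^*$, $\chi_A$ is the characteristic function of $A$, and $\perp$ is a special symbol ("don't know"). A (possibly partial) function $g : \{0,1\}^* \to \{0,1,\perp\}$ is $A$-consistent if for all $x \in \mathrm{dom}(g)$, $g(x) = \chi_A(x)$ or $g(x) = \perp$. For a partial recursive mapping $V : \{0,1\}^* \times \{0,1\}^* \to \{0,1\}^* \cup \{\perp\}$, $x \in \{0,1\}^*$ and $A \subseteq \{0,1\}^*$, define - $C_V(x) = \min\{ l(p) : V(p,\lambda) = x\}$ (Kolmogorov complexity); - $ic_V(x:A) = \min\{ l(p) : z \mapsto V(p,z)$ is a total $A$-consistent function and $V(p,x) = \chi_A(x)\}$ (instance complexity); - $\overline{ic}_V(x:A)$: the same as $ic_V(x:A)$ but without requiring that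 $z \mapsto V(p,z)$ be total; with value $\infty$ if no such $p$ exists. (The output values $0,1$ of $V$ are regarded as the one-letter strings $0,1$.) Fix an optimal partial recursive mapping $U : \{0,1\}^* \times \{0,1\}^* \to \{0,1\}^* \cup \{\perp\}$, i.e., one such that for every partial recursive mapping $V : \{0,1\}^* \times \{0,1\}^* \to \{0,1\}^* \cup \{\perp\}$ there is a constant $d$ with $C_U(x) \leq C_V(x) + d$, $ic_U(x:A) \leq ic_V(x:A) + d$ and $\overline{ic}_U(x:A) \leq \overline{ic}_V(x:A) + d$ for all $x, A$. Write $C$, $ic$, $\overline{ic}$ for $C_U$, $ic_U$, $\overline{ic}_U$. *)

theory Defs
  imports Main "HOL-Library.Nat_Bijection" "HOL-Library.Extended_Nat"
begin

section \<open>Partial recursive functions and r.e. sets\<close>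

text \<open>
  Programs for the partial recursive functions of one argument.  Functions of several
  arguments are handled through the Cantor pairing function \<^const>\<open>prod_encode\<close>, so that
  the projections, pairing, composition, primitive recursion (with one parameter) and
  unbounded minimisation generate exactly Kleene's partial recursive functions.
\<close>

datatype program =
    Zero
  | Succ
  | Fst
  | Snd
  | Pairing program program
  | Comp program program
  | Prec program program
  | Minim program

primrec eval :: "program \<Rightarrow> nat \<Rightarrow> nat option" where
  "eval Zero x = Some 0"
| "eval Succ x = Some (Suc x)"
| "eval Fst x = Some (fst (prod_decode x))"
| "eval Snd x = Some (snd (prod_decode x))"
| "eval (Pairing f g) x =
     Option.bind (eval f x) (\<lambda>a. Option.bind (eval g x) (\<lambda>b. Some (prod_encode (a, b))))"
| "eval (Comp f g) x = Option.bind (eval g x) (eval f)"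
| "eval (Prec f g) x =
     (let (a, n) = prod_decode x in
       rec_nat (eval f a)
         (\<lambda>k r. Option.bind r (\<lambda>v. eval g (prod_encode (a, prod_encode (k, v))))) n)"
| "eval (Minim f) x =
     (if \<exists>n. eval f (prod_encode (x, n)) = Some 0 \<and>
             (\<forall>m<n. eval f (prod_encode (x, m)) \<noteq> None)
      then Some (LEAST n. eval f (prod_encode (x, n)) = Some 0)
      else None)"

text \<open>
  The Goedel numbering has to be effective, which is why it is given explicitly
  rather than obtained from the countability of the datatype.
\<close>

primrec goedel :: "program \<Rightarrow> nat" where
  "goedel Zero = 0"
| "goedel Succ = 1"
| "goedel Fst = 2"
| "goedel Snd = 3"
| "goedel (Pairing f g) = 4 * prod_encode (goedel f, goedel g) + 4"
| "goedel (Comp f g) = 4 * prod_encode (goedel f, goedel g) + 5"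
| "goedel (Prec f g) = 4 * prod_encode (goedel f, goedel g) + 6"
| "goedel (Minim f) = 4 * goedel f + 7"

lemma inj_goedel: "inj goedel"
proof (rule injI)
  fix p q show "goedel p = goedel q \<Longrightarrow> p = q"
  proof (induction p arbitrary: q)
    case Zero then show ?case by (cases q) auto
  next
    case Succ then show ?case by (cases q) auto
  next
    case Fst then show ?case by (cases q) auto
  next
    case Snd then show ?case by (cases q) auto
  next
    case (Pairing f g) then show ?case by (cases q; simp; presburger)
  next
    case (Comp f g) then show ?case by (cases q; simp; presburger)
  next
    case (Prec f g) then show ?case by (cases q; simp; presburger)
  next
    case (Minim f) then show ?case by (cases q; simp; presburger)
  qed
qed

lemma surj_goedel: "surj goedel"
proof -
  have "\<exists>p. goedel p = n" for n
  proof (induction n rule: less_induct)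
    case (less n)
    show ?case
    proof (cases "n < 4")
      case True
      then have "n = 0 \<or> n = 1 \<or> n = 2 \<or> n = 3" by auto
      then show ?thesis by (metis goedel.simps(1-4))
    next
      case False
      define m where "m = (n - 4) div 4"
      obtain a b where ab: "prod_decode m = (a, b)" by fastforce
      then have m: "m = prod_encode (a, b)" by (metis prod_decode_inverse)
      have "a \<le> m" "b \<le> m" using m le_prod_encode_1 le_prod_encode_2 by auto
      moreover have mn: "m < n" using False by (auto simp: m_def)
      ultimately obtain f g where fg: "goedel f = a" "goedel g = b"
        using less by (meson order_le_less_trans)
      obtain h where h: "goedel h = m" using less mn by blast
      have "n = 4 * m + 4 \<or> n = 4 * m + 5 \<or> n = 4 * m + 6 \<or> n = 4 * m + 7"
        using False unfolding m_def by presburger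
      then show ?thesis using m fg h by (metis goedel.simps(5-8))
    qed
  qed
  then show ?thesis by (metis surjI)
qed

lemma bij_goedel: "bij goedel"
  using inj_goedel surj_goedel by (simp add: bij_def)

definition \<phi> :: "nat \<Rightarrow> nat \<Rightarrow> nat option" where
  "\<phi> e = eval (inv goedel e)"

definition W :: "nat \<Rightarrow> nat set" where
  "W e = dom (\<phi> e)"

definition partial_recursive :: "(nat \<Rightarrow> nat option) \<Rightarrow> bool" where
  "partial_recursive f \<longleftrightarrow> (\<exists>p. f = eval p)"

definition total_recursive :: "(nat \<Rightarrow> nat) \<Rightarrow> bool" where
  "total_recursive f \<longleftrightarrow> partial_recursive (\<lambda>x. Some (f x))"

definition re_set :: "nat set \<Rightarrow> bool" where
  "re_set A \<longleftrightarrow> (\<exists>f. partial_recursive f \<and> A = dom f)"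

lemma re_set_iff_W: "re_set A \<longleftrightarrow> (\<exists>e. A = W e)"
proof -
  have "\<exists>e. eval p = \<phi> e" for p
    by (rule exI[of _ "goedel p"]) (simp add: \<phi>_def inj_goedel)
  then show ?thesis
    unfolding re_set_def partial_recursive_def W_def \<phi>_def by metis
qed

definition strongly_effectively_simple :: "nat set \<Rightarrow> bool" where
  "strongly_effectively_simple A \<longleftrightarrow>
     re_set A \<and> infinite (- A) \<and>
     (\<exists>f. total_recursive f \<and> (\<forall>e. W e \<subseteq> - A \<longrightarrow> (\<forall>y\<in>W e. y < f e)))"


section \<open>Binary strings\<close>

type_synonym str = "bool list"

text \<open>
  Position in the length-lexicographic order of all binary strings
  (with \<^const>\<open>False\<close> as \<open>0\<close> and \<^const>\<open>True\<close> as \<open>1\<close>): bijective base-two notation with digits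
  \<open>1\<close> and \<open>2\<close>, most significant digit first.
\<close>

definition nat_of_str :: "str \<Rightarrow> nat" where
  "nat_of_str w = foldl (\<lambda>n b. 2 * n + (if b then 2 else 1)) 0 w"

lemma nat_of_str_Nil [simp]: "nat_of_str [] = 0"
  by (simp add: nat_of_str_def)

lemma nat_of_str_snoc [simp]:
  "nat_of_str (w @ [b]) = 2 * nat_of_str w + (if b then 2 else 1)"
  by (simp add: nat_of_str_def)

lemma bij_nat_of_str: "bij nat_of_str"
proof (rule bijI)
  show "inj nat_of_str"
  proof (rule injI)
    fix u v show "nat_of_str u = nat_of_str v \<Longrightarrow> u = v"
    proof (induction u arbitrary: v rule: rev_induct)
      case Nil
      then show ?case by (cases v rule: rev_cases) (auto split: if_splits)
    next
      case (snoc b u)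
      show ?case
      proof (cases v rule: rev_cases)
        case Nil
        then show ?thesis using snoc.prems by (auto split: if_splits)
      next
        case (snoc v' b')
        then have eq: "2 * nat_of_str u + (if b then 2 else 1) =
            2 * nat_of_str v' + (if b' then 2 else 1)"
          using snoc.prems \<open>nat_of_str (u @ [b]) = nat_of_str v\<close> by simp
        then have "b = b'" by (cases b; cases b'; simp; presburger)
        then show ?thesis using eq snoc snoc.IH \<open>\<And>v. nat_of_str u = nat_of_str v \<Longrightarrow> u = v\<close>
          by auto
      qed
    qed
  qed
next
  have "\<exists>w. nat_of_str w = n" for n
  proof (induction n rule: less_induct)
    case (less n)
    show ?case
    proof (cases "n = 0")
      case True
      then show ?thesis using nat_of_str_Nil by blast
    next
      case False
      then have "(n - 1) div 2 < n" by linarith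
      then obtain w where w: "nat_of_str w = (n - 1) div 2"
        using less by blast
      have "n = 2 * nat_of_str w + 1 \<or> n = 2 * nat_of_str w + 2"
        unfolding w using False by presburger
      then show ?thesis
        using nat_of_str_snoc[of w True] nat_of_str_snoc[of w False] by metis
    qed
  qed
  then show "surj nat_of_str" by (metis surjI)
qed

lemma nat_of_str_less_iff:
  "nat_of_str u < nat_of_str v \<longleftrightarrow> (u, v) \<in> lenlex {(False, True)}"
proof -
  have trichotomy: "(u, v) \<in> lenlex {(False, True)} \<or> u = v \<or> (v, u) \<in> lenlex {(False, True)}" for u v
    using total_lenlex[of "{(False, True)}"] by (auto simp: total_on_def)
  have bound: "2 ^ length w \<le> Suc (nat_of_str w) \<and> Suc (nat_of_str w) < 2 ^ Suc (length w)" for w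
    by (induction w rule: rev_induct) auto
  have step: "foldl (\<lambda>n b. 2 * n + (if b then 2 else 1)) a w = 2 ^ length w * a + nat_of_str w" for a w
    by (induction w rule: rev_induct) (auto simp: algebra_simps)
  have mono: "nat_of_str u < nat_of_str v" if uv: "(u, v) \<in> lenlex {(False, True)}" for u v
  proof (cases "length u = length v")
    case True
    then obtain xs us vs where "u = xs @ False # us" "v = xs @ True # vs" "length us = length vs"
      using uv by (auto simp: lenlex_conv lex_conv)
    moreover have "nat_of_str (xs @ b # ws) =
        2 ^ length ws * (2 * nat_of_str xs + (if b then 2 else 1)) + nat_of_str ws" for b ws
      using step[of "2 * nat_of_str xs + (if b then 2 else 1)" ws]
      by (simp add: nat_of_str_def)
    ultimately show ?thesis using bound[of us] bound[of vs]
      by (simp add: algebra_simps)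
  next
    case False
    then have "Suc (length u) \<le> length v" using uv by (auto simp: lenlex_conv)
    then have "(2::nat) ^ Suc (length u) \<le> 2 ^ length v" by (rule power_increasing) simp
    then show ?thesis using bound[of u] bound[of v] by linarith
  qed
  show ?thesis using trichotomy[of u v] mono[of u v] mono[of v u] by auto
qed


section \<open>Kolmogorov complexity and instance complexity\<close>

datatype answer = Bot | Str str

fun nat_of_answer :: "answer \<Rightarrow> nat" where
  "nat_of_answer Bot = 0"
| "nat_of_answer (Str w) = Suc (nat_of_str w)"

text \<open>The outer \<^const>\<open>None\<close> means divergence and is different from the output \<^const>\<open>Bot\<close>.\<close>

type_synonym mapping = "str \<Rightarrow> str \<Rightarrow> answer option"

definition partial_recursive_mapping :: "mapping \<Rightarrow> bool" where
  "partial_recursive_mapping V \<longleftrightarrow>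
     (\<exists>f. partial_recursive f \<and>
       (\<forall>p z. map_option nat_of_answer (V p z) =
              f (prod_encode (nat_of_str p, nat_of_str z))))"

definition chi :: "str set \<Rightarrow> str \<Rightarrow> answer" where
  "chi A x = Str [x \<in> A]"

definition consistent :: "str set \<Rightarrow> (str \<Rightarrow> answer option) \<Rightarrow> bool" where
  "consistent A g \<longleftrightarrow> (\<forall>x\<in>dom g. g x = Some (chi A x) \<or> g x = Some Bot)"

text \<open>In \<^typ>\<open>enat\<close>, the infimum of a nonempty set is its minimum, and that of the empty set is \<open>\<infinity>\<close>.\<close>

definition kolm :: "mapping \<Rightarrow> str \<Rightarrow> enat" where
  "kolm V x = Inf {enat (length p) | p. V p [] = Some (Str x)}"

definition ic :: "mapping \<Rightarrow> str \<Rightarrow> str set \<Rightarrow> enat" where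
  "ic V x A = Inf {enat (length p) | p.
     dom (V p) = UNIV \<and> consistent A (V p) \<and> V p x = Some (chi A x)}"

definition ic_bar :: "mapping \<Rightarrow> str \<Rightarrow> str set \<Rightarrow> enat" where
  "ic_bar V x A = Inf {enat (length p) | p.
     consistent A (V p) \<and> V p x = Some (chi A x)}"

definition optimal :: "mapping \<Rightarrow> bool" where
  "optimal U \<longleftrightarrow> partial_recursive_mapping U \<and>
     (\<forall>V. partial_recursive_mapping V \<longrightarrow>
       (\<exists>d::nat. \<forall>x A. kolm U x \<le> kolm V x + enat d \<and>
                        ic U x A \<le> ic V x A + enat d \<and>
                        ic_bar U x A \<le> ic_bar V x A + enat d))"

end

theory Submission
  imports Defs
begin

text \<open>
  Write \<open>B\<^sub>p\<close> for the set of \<open>x\<close> with \<open>U(p, x) = 0\<close>. If \<open>B\<^sub>p\<close> is disjoint from \<open>A\<close> then, \<open>A\<close> being strongly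
  effectively simple, \<open>B\<^sub>p\<close> is bounded by \<open>F(l(p))\<close> for a monotone recursive \<open>F\<close>. At stage \<open>s\<close> let slot
  \<open>l\<close> be occupied if some \<open>p\<close> of length \<open>l\<close>, not yet seen to meet \<open>A\<close>, covers a witness \<open>x \<ge> F(k)\<close>,
  where \<open>k\<close> is the last occupied slot below \<open>l\<close>. In the limit infinitely many slots are occupied
  (unless \<open>\<infinity>\<close> is the value of the instance complexity infinitely often), and no consistent program
  shorter than \<open>l\<close> covers a limit witness \<open>x\<close> of slot \<open>l\<close>: programs of length at most \<open>k\<close> only reach
  below \<open>F(k)\<close>, and the slots strictly between \<open>k\<close> and \<open>l\<close> are empty.

  It remains to describe \<open>x\<close> by \<open>l + O(1)\<close> bits. The number of occupied slots up to \<open>l\<close> plus the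
  number of programs of length at most \<open>l\<close> seen to meet \<open>A\<close> is nondecreasing in \<open>s\<close> and below
  \<open>2\<^sup>l\<^sup>+\<^sup>2\<close>: a newly occupied slot makes at most the next occupied one invalid. If slot \<open>l\<close> is
  occupied in the limit then any witness it has while this number is final is a limit witness, so \<open>l\<close> and that value determine \<open>x\<close>.
\<close>

section \<open>Total recursive functions and decidable predicates\<close>

abbreviation pfst :: "nat \<Rightarrow> nat" where "pfst x \<equiv> fst (prod_decode x)"
abbreviation psnd :: "nat \<Rightarrow> nat" where "psnd x \<equiv> snd (prod_decode x)"

abbreviation decidable :: "(nat \<Rightarrow> bool) \<Rightarrow> bool" where
  "decidable P \<equiv> total_recursive (\<lambda>x. of_bool (P x))"

named_theorems recursive_intros

lemma total_recursive_iff: "total_recursive f \<longleftrightarrow> (\<exists>p. \<forall>x. eval p x = Some (f x))"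
  unfolding total_recursive_def partial_recursive_def by (metis ext)

lemma total_recursive_id [recursive_intros]: "total_recursive (\<lambda>x. x)"
  unfolding total_recursive_iff by (rule exI[of _ "Pairing Fst Snd"]) simp

lemma total_recursive_comp:
  assumes "total_recursive f" "total_recursive g"
  shows "total_recursive (\<lambda>x. f (g x))"
proof -
  from assms obtain p q where "\<forall>x. eval p x = Some (f x)" "\<forall>x. eval q x = Some (g x)"
    unfolding total_recursive_iff by blast
  then have "\<forall>x. eval (Comp p q) x = Some (f (g x))" by simp
  then show ?thesis unfolding total_recursive_iff by blast
qed

lemma total_recursive_Suc [recursive_intros]:
  "total_recursive f \<Longrightarrow> total_recursive (\<lambda>x. Suc (f x))"
  by (rule total_recursive_comp[of Suc], unfold total_recursive_iff, rule exI[of _ Succ]) simp_all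

lemma total_recursive_pfst [recursive_intros]:
  "total_recursive f \<Longrightarrow> total_recursive (\<lambda>x. pfst (f x))"
  by (rule total_recursive_comp[of pfst], unfold total_recursive_iff, rule exI[of _ Fst]) simp_all

lemma total_recursive_psnd [recursive_intros]:
  "total_recursive f \<Longrightarrow> total_recursive (\<lambda>x. psnd (f x))"
  by (rule total_recursive_comp[of psnd], unfold total_recursive_iff, rule exI[of _ Snd]) simp_all

lemma total_recursive_const [recursive_intros]: "total_recursive (\<lambda>x. c)"
proof (induction c)
  case 0
  show ?case unfolding total_recursive_iff by (rule exI[of _ Zero]) simp
qed (rule total_recursive_Suc)

lemma total_recursive_pair [recursive_intros]:
  assumes "total_recursive f" "total_recursive g"
  shows "total_recursive (\<lambda>x. prod_encode (f x, g x))"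
proof -
  from assms obtain p q where "\<forall>x. eval p x = Some (f x)" "\<forall>x. eval q x = Some (g x)"
    unfolding total_recursive_iff by blast
  then have "\<forall>x. eval (Pairing p q) x = Some (prod_encode (f x, g x))" by simp
  then show ?thesis unfolding total_recursive_iff by blast
qed

text \<open>Turns recursiveness on coded pairs into a closure rule for arbitrary recursive
  arguments, the form needed under bound variables.\<close>

lemma total_recursive_comp2:
  assumes "total_recursive (\<lambda>z. f (pfst z) (psnd z))" "total_recursive g" "total_recursive h"
  shows "total_recursive (\<lambda>x. f (g x) (h x))"
  using total_recursive_comp[OF assms(1) total_recursive_pair[OF assms(2,3)]] by simp

lemma total_recursive_rec_nat [recursive_intros]:
  assumes "total_recursive b"
    and "total_recursive (\<lambda>y. g (pfst y) (pfst (psnd y)) (psnd (psnd y)))"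
    and "total_recursive n"
  shows "total_recursive (\<lambda>x. rec_nat (b x) (\<lambda>k r. g x k r) (n x))"
proof -
  from assms obtain pb pg pn where p: "\<forall>x. eval pb x = Some (b x)"
    "\<forall>y. eval pg y = Some (g (pfst y) (pfst (psnd y)) (psnd (psnd y)))"
    "\<forall>x. eval pn x = Some (n x)"
    unfolding total_recursive_iff by blast
  have "rec_nat (Some (b x)) (\<lambda>k r. Option.bind r (\<lambda>v. eval pg (prod_encode (x, prod_encode (k, v))))) m
      = Some (rec_nat (b x) (\<lambda>k r. g x k r) m)" for x m
    by (induction m) (simp_all add: p)
  \<comment> \<open>\<open>Pairing Fst Snd\<close> is the identity: the whole input \<open>x\<close>
    is the parameter of the recursion.\<close>
  then have "\<forall>x. eval (Comp (Prec pb pg) (Pairing (Pairing Fst Snd) pn)) x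
      = Some (rec_nat (b x) (\<lambda>k r. g x k r) (n x))"
    by (simp add: p)
  then show ?thesis unfolding total_recursive_iff by blast
qed

lemma total_recursive_add [recursive_intros]:
  assumes "total_recursive f" "total_recursive g"
  shows "total_recursive (\<lambda>x. f x + g x)"
proof -
  have eq: "m + n = rec_nat m (\<lambda>k r. Suc r) n" for m n by (induction n) simp_all
  show ?thesis unfolding eq by (intro recursive_intros assms)
qed

lemma total_recursive_mult [recursive_intros]:
  assumes "total_recursive f" "total_recursive g"
  shows "total_recursive (\<lambda>x. f x * g x)"
proof -
  have "m * n = rec_nat 0 (\<lambda>k r. r + m) n" for m n :: nat by (induction n) simp_all
  then have eq: "(\<lambda>x. f x * g x) = (\<lambda>x. rec_nat 0 (\<lambda>k r. r + f x) (g x))" by simp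
  show ?thesis unfolding eq
    by (intro recursive_intros total_recursive_comp[OF assms(1)] assms)
qed

lemma total_recursive_diff [recursive_intros]:
  assumes "total_recursive f" "total_recursive g"
  shows "total_recursive (\<lambda>x. f x - g x)"
proof -
  have "m - 1 = rec_nat 0 (\<lambda>k r. k) m" for m by (induction m) simp_all
  moreover have "total_recursive (\<lambda>m. rec_nat 0 (\<lambda>k r. k) m)" by (intro recursive_intros)
  ultimately have pred: "total_recursive (\<lambda>m. m - 1)" by simp
  have "m - n = rec_nat m (\<lambda>k r. r - 1) n" for m n :: nat by (induction n) simp_all
  then have eq: "(\<lambda>x. f x - g x) = (\<lambda>x. rec_nat (f x) (\<lambda>k r. r - 1) (g x))" by (rule ext)
  show ?thesis unfolding eq
    by (intro total_recursive_rec_nat assms total_recursive_comp[OF pred] recursive_intros)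
qed

lemma total_recursive_power2 [recursive_intros]:
  assumes "total_recursive f"
  shows "total_recursive (\<lambda>x. 2 ^ f x)"
proof -
  have eq: "2 ^ n = (rec_nat 1 (\<lambda>k r. r + r) n :: nat)" for n by (induction n) simp_all
  show ?thesis unfolding eq by (intro recursive_intros assms)
qed

lemma total_recursive_sum [recursive_intros]:
  assumes "total_recursive (\<lambda>y. f (pfst y) (psnd y))" "total_recursive n"
  shows "total_recursive (\<lambda>x. \<Sum>k<n x. f x k)"
proof -
  have eq: "(\<Sum>k<m. h k) = rec_nat 0 (\<lambda>k r. r + h k) m" for m and h :: "nat \<Rightarrow> nat"
    by (induction m) simp_all
  show ?thesis unfolding eq
    by (intro recursive_intros total_recursive_comp2[OF assms(1)] assms(2))
qed

lemma decidable_le [recursive_intros]: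
  assumes "total_recursive f" "total_recursive g"
  shows "decidable (\<lambda>x. f x \<le> g x)"
proof -
  have "of_bool (m \<le> n) = 1 - (m - n)" for m n :: nat by (auto simp: of_bool_def)
  then have eq: "(\<lambda>x. of_bool (f x \<le> g x)) = (\<lambda>x. 1 - (f x - g x))" by simp
  show ?thesis unfolding eq by (intro recursive_intros assms)
qed

lemma decidable_not [recursive_intros]:
  assumes "decidable P"
  shows "decidable (\<lambda>x. \<not> P x)"
proof -
  have eq: "(\<lambda>x. of_bool (\<not> P x)) = (\<lambda>x. 1 - (of_bool (P x) :: nat))"
  proof
    show "of_bool (\<not> P x) = 1 - (of_bool (P x) :: nat)" for x by (cases "P x") simp_all
  qed
  show ?thesis unfolding eq by (intro recursive_intros assms)
qed

lemma decidable_less [recursive_intros]: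
  assumes "total_recursive f" "total_recursive g"
  shows "decidable (\<lambda>x. f x < g x)"
  using decidable_not[OF decidable_le[OF assms(2,1)]] by (simp add: not_le del: of_bool_not_iff)

lemma decidable_conj [recursive_intros]:
  assumes "decidable P" "decidable Q"
  shows "decidable (\<lambda>x. P x \<and> Q x)"
  unfolding of_bool_conj by (intro recursive_intros assms)

lemma decidable_eq [recursive_intros]:
  assumes "total_recursive f" "total_recursive g"
  shows "decidable (\<lambda>x. f x = g x)"
  unfolding order.eq_iff[where ?'a = nat] by (intro recursive_intros assms)

lemma decidable_bex [recursive_intros]:
  assumes "decidable (\<lambda>y. P (pfst y) (psnd y))" "total_recursive n"
  shows "decidable (\<lambda>x. \<exists>k<n x. P x k)"
proof -
  have "(\<exists>k<m. Q k) \<longleftrightarrow> 0 < (\<Sum>k<m. of_bool (Q k) :: nat)" for m and Q :: "nat \<Rightarrow> bool"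
    by (auto simp: card_gt_0_iff)
  then show ?thesis
    by (simp only:) (intro recursive_intros total_recursive_comp2[OF assms(1)] assms(2))
qed

lemma decidable_ball [recursive_intros]:
  assumes "decidable (\<lambda>y. P (pfst y) (psnd y))" "total_recursive n"
  shows "decidable (\<lambda>x. \<forall>k<n x. P x k)"
proof -
  have "decidable (\<lambda>x. \<not> (\<exists>k<n x. \<not> P x k))" by (intro recursive_intros assms)
  then show ?thesis by simp
qed

lemma total_recursive_if [recursive_intros]:
  assumes "decidable P" "total_recursive f" "total_recursive g"
  shows "total_recursive (\<lambda>x. if P x then f x else g x)"
proof -
  have eq: "(if b then m else n) = of_bool b * m + of_bool (\<not> b) * n" for b and m n :: nat by simp
  show ?thesis unfolding eq by (intro recursive_intros assms)
qed

lemma partial_recursive_comp: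
  assumes "partial_recursive f" "partial_recursive g"
  shows "partial_recursive (\<lambda>x. Option.bind (g x) f)"
proof -
  from assms obtain p q where "f = eval p" "g = eval q" unfolding partial_recursive_def by blast
  then have "(\<lambda>x. Option.bind (g x) f) = eval (Comp p q)" by auto
  then show ?thesis unfolding partial_recursive_def by blast
qed

lemma partial_recursive_Least:
  assumes "decidable (\<lambda>y. P (pfst y) (psnd y))"
  shows "partial_recursive (\<lambda>x. if \<exists>n. P x n then Some (LEAST n. P x n) else None)"
proof -
  \<comment> \<open>\<open>Minim\<close> searches for the value 0, hence the negation; totality of
    the test settles its condition on earlier values.\<close>
  have "decidable (\<lambda>y. \<not> P (pfst y) (psnd y))" by (intro recursive_intros assms)
  then obtain p where "\<forall>y. eval p y = Some (of_bool (\<not> P (pfst y) (psnd y)))"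
    unfolding total_recursive_iff by blast
  then have "eval (Minim p) = (\<lambda>x. if \<exists>n. P x n then Some (LEAST n. P x n) else None)"
    by auto
  then show ?thesis unfolding partial_recursive_def by metis
qed


section \<open>Step-bounded evaluation\<close>

text \<open>The result \<open>0\<close> means that no value has been found with bound \<open>s\<close>; a value \<open>y\<close> is reported
  as \<open>Suc y\<close>. Only the minimisation searches are cut off. In the sum for \<^const>\<open>Minim\<close> at most one
  term is nonzero.\<close>

primrec steps :: "program \<Rightarrow> nat \<Rightarrow> nat \<Rightarrow> nat" where
  "steps Zero s x = 1"
| "steps Succ s x = Suc (Suc x)"
| "steps Fst s x = Suc (pfst x)"
| "steps Snd s x = Suc (psnd x)"
| "steps (Pairing f g) s x =
     (if 0 < steps f s x \<and> 0 < steps g s x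
      then Suc (prod_encode (steps f s x - 1, steps g s x - 1)) else 0)"
| "steps (Comp f g) s x = (if 0 < steps g s x then steps f s (steps g s x - 1) else 0)"
| "steps (Prec f g) s x =
     rec_nat (steps f s (pfst x))
       (\<lambda>k r. if 0 < r then steps g s (prod_encode (pfst x, prod_encode (k, r - 1))) else 0)
       (psnd x)"
| "steps (Minim f) s x =
     (\<Sum>n<s. if steps f s (prod_encode (x, n)) = 1 \<and> (\<forall>m<n. 1 < steps f s (prod_encode (x, m)))
             then Suc n else 0)"

lemma steps_Prec_Suc:
  "steps (Prec f g) s (prod_encode (a, Suc n)) =
    (if 0 < steps (Prec f g) s (prod_encode (a, n))
     then steps g s (prod_encode (a, prod_encode (n, steps (Prec f g) s (prod_encode (a, n)) - 1)))
     else 0)"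
  unfolding steps.simps prod_encode_inverse fst_conv snd_conv by simp

text \<open>As \<open>p\<close> is fixed and only the bound and the input vary, structural induction
  suffices and no universal program has to be built.\<close>

lemma total_recursive_steps:
  assumes "total_recursive f" "total_recursive g"
  shows "total_recursive (\<lambda>x. steps p (f x) (g x))"
proof -
  have "total_recursive (\<lambda>y. steps p (pfst y) (psnd y))"
  proof (induction p)
    case (Pairing p q)
    show ?case by (simp only: steps.simps)
        (intro recursive_intros total_recursive_comp2[OF Pairing(1)] total_recursive_comp2[OF Pairing(2)])
  next
    case (Comp p q)
    show ?case by (simp only: steps.simps)
        (intro recursive_intros total_recursive_comp2[OF Comp(1)] total_recursive_comp2[OF Comp(2)])
  next
    case (Prec p q)
    show ?case by (simp only: steps.simps)
        (intro recursive_intros total_recursive_comp2[OF Prec(1)] total_recursive_comp2[OF Prec(2)])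
  next
    case (Minim p)
    show ?case by (simp only: steps.simps)
        (intro recursive_intros total_recursive_comp2[OF Minim])
  qed (simp_all only: steps.simps, (intro recursive_intros)+)
  from total_recursive_comp2[OF this assms] show ?thesis .
qed

text \<open>Two indices cannot both qualify: the smaller one would need the result 1 as well as a
  result above 1.\<close>

lemma steps_Minim_eq_Suc_iff:
  "steps (Minim f) s x = Suc n \<longleftrightarrow>
    n < s \<and> steps f s (prod_encode (x, n)) = 1 \<and> (\<forall>m<n. 1 < steps f s (prod_encode (x, m)))"
  (is "_ \<longleftrightarrow> n < s \<and> ?P n")
proof -
  have one: "(\<Sum>n<s. if ?P n then Suc n else 0) = (if n < s then Suc n else 0)" if n: "?P n" for n
  proof -
    have "?P k \<longleftrightarrow> k = n" for k
    proof
      assume "?P k"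
      then show "k = n" using n by (cases k n rule: linorder_cases) auto
    qed (use n in simp)
    then have "(\<Sum>k<s. if ?P k then Suc k else 0) = (\<Sum>k<s. if k = n then Suc k else 0)"
      by (intro sum.cong) auto
    then show ?thesis by (simp add: sum.delta)
  qed
  show ?thesis
  proof
    assume L: "steps (Minim f) s x = Suc n"
    then have "(\<Sum>n<s. if ?P n then Suc n else 0) \<noteq> 0" by simp
    then obtain k where "k \<in> {..<s}" "(if ?P k then Suc k else 0) \<noteq> 0"
      by (rule sum.not_neutral_contains_not_neutral)
    then have k: "k < s" "?P k" by (simp_all split: if_splits)
    with one[of k] L have "k = n" by (simp split: if_splits)
    with k show "n < s \<and> ?P n" by simp
  next
    assume "n < s \<and> ?P n"
    then show "steps (Minim f) s x = Suc n" using one[of n] by simp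
  qed
qed

lemma steps_mono: "steps p s x = Suc y \<Longrightarrow> s \<le> s' \<Longrightarrow> steps p s' x = Suc y"
proof (induction p arbitrary: x y)
  case (Pairing f g)
  from Pairing.prems obtain a b where "steps f s x = Suc a" "steps g s x = Suc b"
    by (auto simp: gr0_conv_Suc split: if_splits)
  with Pairing show ?case by simp
next
  case (Comp f g)
  from Comp.prems obtain a where "steps g s x = Suc a"
    by (auto simp: gr0_conv_Suc split: if_splits)
  with Comp show ?case by simp
next
  case (Prec f g)
  have "rec_nat (steps f s a)
       (\<lambda>k r. if 0 < r then steps g s (prod_encode (a, prod_encode (k, r - 1))) else 0) n = Suc y \<Longrightarrow>
     rec_nat (steps f s' a)
       (\<lambda>k r. if 0 < r then steps g s' (prod_encode (a, prod_encode (k, r - 1))) else 0) n = Suc y"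
    for a n y
  proof (induction n arbitrary: y)
    case 0
    then show ?case using Prec by simp
  next
    case (Suc n)
    from Suc.prems obtain z where z: "rec_nat (steps f s a)
       (\<lambda>k r. if 0 < r then steps g s (prod_encode (a, prod_encode (k, r - 1))) else 0) n = Suc z"
      by (auto simp: gr0_conv_Suc split: if_splits)
    with Suc.prems have "steps g s (prod_encode (a, prod_encode (n, z))) = Suc y" by simp
    then have "steps g s' (prod_encode (a, prod_encode (n, z))) = Suc y"
      using Prec.IH(2) Prec.prems(2) by blast
    then show ?case using Suc.IH[OF z] by simp
  qed
  then show ?case using Prec.prems by simp
next
  case (Minim f)
  \<comment> \<open>A positive result is a \<open>Suc\<close>, so the induction hypothesis freezes
    it.\<close>
  have "steps f s' z = steps f s z" if "0 < steps f s z" for z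
    using that Minim.IH[OF _ Minim.prems(2)] by (cases "steps f s z") auto
  note mono = this
  from Minim.prems(1) have y: "y < s" "steps f s (prod_encode (x, y)) = 1"
    "\<forall>m<y. 1 < steps f s (prod_encode (x, m))"
    unfolding steps_Minim_eq_Suc_iff by auto
  have "steps f s' (prod_encode (x, m)) = steps f s (prod_encode (x, m))" if "m \<le> y" for m
  proof (rule mono, cases "m = y")
    case False
    with that y(3) have "1 < steps f s (prod_encode (x, m))" by simp
    then show "0 < steps f s (prod_encode (x, m))" by simp
  qed (use y(2) in simp)
  then show ?case using y Minim.prems(2) unfolding steps_Minim_eq_Suc_iff by simp
qed simp_all

lemma steps_sound: "steps p s x = Suc y \<Longrightarrow> eval p x = Some y"
proof (induction p arbitrary: x y)
  case (Pairing f g)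
  from Pairing.prems obtain a b where "steps f s x = Suc a" "steps g s x = Suc b"
    by (auto simp: gr0_conv_Suc split: if_splits)
  with Pairing show ?case by simp
next
  case (Comp f g)
  from Comp.prems obtain a where "steps g s x = Suc a"
    by (auto simp: gr0_conv_Suc split: if_splits)
  with Comp show ?case by simp
next
  case (Prec f g)
  have "rec_nat (steps f s a)
       (\<lambda>k r. if 0 < r then steps g s (prod_encode (a, prod_encode (k, r - 1))) else 0) n = Suc y \<Longrightarrow>
     rec_nat (eval f a)
         (\<lambda>k r. Option.bind r (\<lambda>v. eval g (prod_encode (a, prod_encode (k, v))))) n = Some y"
    for a n y
  proof (induction n arbitrary: y)
    case 0
    then show ?case using Prec by simp
  next
    case (Suc n)
    from Suc.prems obtain z where z: "rec_nat (steps f s a)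
       (\<lambda>k r. if 0 < r then steps g s (prod_encode (a, prod_encode (k, r - 1))) else 0) n = Suc z"
      by (auto simp: gr0_conv_Suc split: if_splits)
    with Suc.prems have "steps g s (prod_encode (a, prod_encode (n, z))) = Suc y" by simp
    then show ?case using Suc.IH[OF z] Prec.IH(2) by simp
  qed
  then show ?case using Prec.prems by (simp add: case_prod_unfold)
next
  case (Minim f)
  have n: "eval f (prod_encode (x, y)) = Some 0"
    using Minim unfolding steps_Minim_eq_Suc_iff by simp
  have m: "\<exists>v. eval f (prod_encode (x, m)) = Some (Suc v)" if "m < y" for m
  proof -
    from that Minim.prems have "1 < steps f s (prod_encode (x, m))"
      unfolding steps_Minim_eq_Suc_iff by simp
    then have "steps f s (prod_encode (x, m)) = Suc (Suc (steps f s (prod_encode (x, m)) - 2))"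
      by simp
    then show ?thesis using Minim.IH by blast
  qed
  have "(LEAST n. eval f (prod_encode (x, n)) = Some 0) = y"
  proof (rule Least_equality)
    show "eval f (prod_encode (x, y)) = Some 0" by (rule n)
    fix k assume "eval f (prod_encode (x, k)) = Some 0"
    then show "y \<le> k" using m[of k] by (cases "k < y") auto
  qed
  moreover have "\<exists>n. eval f (prod_encode (x, n)) = Some 0 \<and> (\<forall>m<n. eval f (prod_encode (x, m)) \<noteq> None)"
    using n m by fastforce
  ultimately show ?case by simp
qed simp_all

lemma steps_complete: "eval p x = Some y \<Longrightarrow> \<exists>s. steps p s x = Suc y"
proof (induction p arbitrary: x y)
  case (Pairing f g)
  from Pairing.prems obtain a b where ab: "eval f x = Some a" "eval g x = Some b"
    "y = prod_encode (a, b)" by (auto simp: bind_eq_Some_conv)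
  from Pairing.IH ab obtain s t where "steps f s x = Suc a" "steps g t x = Suc b" by metis
  then have "steps f (max s t) x = Suc a" "steps g (max s t) x = Suc b"
    using steps_mono by (meson max.cobounded1 max.cobounded2)+
  with ab have "steps (Pairing f g) (max s t) x = Suc y" by simp
  then show ?case by blast
next
  case (Comp f g)
  from Comp.prems obtain a where a: "eval g x = Some a" "eval f a = Some y"
    by (auto simp: bind_eq_Some_conv)
  from Comp.IH a obtain s t where "steps g s x = Suc a" "steps f t a = Suc y" by metis
  then have "steps g (max s t) x = Suc a" "steps f (max s t) a = Suc y"
    using steps_mono by (meson max.cobounded1 max.cobounded2)+
  then have "steps (Comp f g) (max s t) x = Suc y" by simp
  then show ?case by blast
next
  case (Prec f g)
  have "rec_nat (eval f a)
         (\<lambda>k r. Option.bind r (\<lambda>v. eval g (prod_encode (a, prod_encode (k, v))))) n = Some y \<Longrightarrow>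
     \<exists>s. steps (Prec f g) s (prod_encode (a, n)) = Suc y" for a n y
  proof (induction n arbitrary: y)
    case 0
    then show ?case using Prec by simp
  next
    case (Suc n)
    from Suc.prems obtain z where z: "rec_nat (eval f a)
         (\<lambda>k r. Option.bind r (\<lambda>v. eval g (prod_encode (a, prod_encode (k, v))))) n = Some z"
      and y: "eval g (prod_encode (a, prod_encode (n, z))) = Some y"
      by (auto simp: bind_eq_Some_conv)
    from Suc.IH[OF z] Prec.IH(2)[OF y] obtain s t
      where "steps (Prec f g) s (prod_encode (a, n)) = Suc z"
        "steps g t (prod_encode (a, prod_encode (n, z))) = Suc y" by metis
    then have "steps (Prec f g) (max s t) (prod_encode (a, n)) = Suc z"
        "steps g (max s t) (prod_encode (a, prod_encode (n, z))) = Suc y"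
      using steps_mono by (meson max.cobounded1 max.cobounded2)+
    then have "steps (Prec f g) (max s t) (prod_encode (a, Suc n)) = Suc y"
      unfolding steps_Prec_Suc by (simp del: steps.simps)
    then show ?case by blast
  qed
  from this[of "pfst x" "psnd x"] Prec.prems show ?case
    by (simp add: case_prod_unfold Let_def)
next
  case (Minim f)
  let ?P = "\<lambda>n. eval f (prod_encode (x, n)) = Some 0"
  from Minim.prems obtain n where n: "?P n" "\<forall>m<n. eval f (prod_encode (x, m)) \<noteq> None"
    and y: "y = (LEAST n. ?P n)" by (auto split: if_splits)
  have y0: "?P y" "y \<le> n" using n y by (auto intro: LeastI Least_le)
  have lt: "\<exists>v. eval f (prod_encode (x, m)) = Some (Suc v)" if "m < y" for m
  proof -
    from that y have "\<not> ?P m" by (blast dest: not_less_Least)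
    moreover obtain w where "eval f (prod_encode (x, m)) = Some w"
      using n(2) y0(2) \<open>m < y\<close> by (meson not_None_eq order_less_le_trans)
    ultimately show ?thesis by (cases w) auto
  qed
  \<comment> \<open>Each argument below \<open>y\<close> has its own bound; the induction merges
    these finitely many into one.\<close>
  have "\<exists>s. \<forall>m<k. 1 < steps f s (prod_encode (x, m))" if "k \<le> y" for k
    using that
  proof (induction k)
    case (Suc k)
    then obtain s where s: "\<forall>m<k. 1 < steps f s (prod_encode (x, m))" by auto
    obtain t v where v: "steps f t (prod_encode (x, k)) = Suc (Suc v)"
      using lt[of k] Minim.IH Suc.prems by (metis Suc_le_lessD)
    have "1 < steps f (max s t) (prod_encode (x, m))" if "m < Suc k" for m
    proof (cases "m = k")
      case True
      then show ?thesis using steps_mono[OF v, of "max s t"] by simp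
    next
      case False
      with that s have "1 < steps f s (prod_encode (x, m))" by simp
      then show ?thesis using steps_mono[of f s "prod_encode (x, m)" _ "max s t"]
        by (cases "steps f s (prod_encode (x, m))") auto
    qed
    then show ?case by blast
  qed simp
  then obtain s where s: "\<forall>m<y. 1 < steps f s (prod_encode (x, m))" by blast
  obtain t where t: "steps f t (prod_encode (x, y)) = Suc 0" using Minim.IH y0 by blast
  \<comment> \<open>\<open>Suc y\<close> is included because the sum for \<open>Minim\<close> ranges
    over indices strictly below the bound.\<close>
  define r where "r = max (max s t) (Suc y)"
  have "1 < steps f r (prod_encode (x, m))" if "m < y" for m
    using s that steps_mono[of f s "prod_encode (x, m)" _ r]
    by (cases "steps f s (prod_encode (x, m))") (auto simp: r_def)
  moreover have "steps f r (prod_encode (x, y)) = 1"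
    using steps_mono[OF t, of r] by (simp add: r_def)
  moreover have "y < r" by (simp add: r_def)
  ultimately have "steps (Minim f) r x = Suc y" unfolding steps_Minim_eq_Suc_iff by simp
  then show ?case by blast
qed simp_all

lemma eval_eq_Some_iff: "eval p x = Some y \<longleftrightarrow> (\<exists>s. steps p s x = Suc y)"
  using steps_sound steps_complete by blast


section \<open>The race between programs and enumerations\<close>

text \<open>A program with code \<open>q\<close> is represented here by \<open>n = Suc q\<close>, so that the programs of length
  \<open>l\<close> are exactly the numbers in \<open>{2 ^ l..<2 ^ Suc l}\<close>. The value \<open>n = 0\<close> belongs to no length.\<close>


lemma power_ivl_unique:
  assumes "2 ^ k \<le> n" "n < 2 ^ Suc k" "2 ^ l \<le> n" "n < (2::nat) ^ Suc l"
  shows "k = l"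
proof (rule ccontr)
  assume "k \<noteq> l"
  then have "Suc k \<le> l \<or> Suc l \<le> k" by linarith
  then have "(2::nat) ^ Suc k \<le> 2 ^ l \<or> (2::nat) ^ Suc l \<le> 2 ^ k"
    using power_increasing[of _ _ "2::nat"] by (metis one_le_numeral)
  with assms show False by linarith
qed

text \<open>Intended reading: by stage \<open>s\<close>, program \<open>n\<close> is seen to answer
  0 on \<open>x\<close> (\<open>cov s n x\<close>), and \<open>x\<close> is enumerated into the set
  (\<open>inA s x\<close>). Strong effective simplicity enters through
  \<open>F_bound\<close>.\<close>

locale cover_race =
  fixes cov :: "nat \<Rightarrow> nat \<Rightarrow> nat \<Rightarrow> bool" and inA :: "nat \<Rightarrow> nat \<Rightarrow> bool" and F :: "nat \<Rightarrow> nat"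
  assumes cov_mono: "s \<le> s' \<Longrightarrow> cov s n x \<Longrightarrow> cov s' n x"
    and inA_mono: "s \<le> s' \<Longrightarrow> inA s x \<Longrightarrow> inA s' x"
    and F_mono: "k \<le> l \<Longrightarrow> F k \<le> F l"
    and F_ge: "l \<le> F l"
    and F_bound: "2 ^ l \<le> n \<Longrightarrow> n < 2 ^ Suc l \<Longrightarrow> (\<And>s y. cov s n y \<Longrightarrow> \<not> inA s y) \<Longrightarrow>
      cov s n x \<Longrightarrow> x < F l"
begin

definition dead :: "nat \<Rightarrow> nat \<Rightarrow> bool" where
  "dead s n \<longleftrightarrow> (\<exists>y<s. cov s n y \<and> inA s y)"

definition can_fill :: "nat \<Rightarrow> nat \<Rightarrow> nat \<Rightarrow> nat \<Rightarrow> nat \<Rightarrow> bool" where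
  "can_fill s l r n y \<longleftrightarrow> 2 ^ l \<le> n \<and> n < 2 ^ Suc l \<and> \<not> dead s n \<and> y < s \<and> r \<le> y \<and> cov s n y"

text \<open>The threshold \<open>r\<close> is a parameter so that \<open>thr\<close> can be a plain
  primitive recursion, with \<open>occ\<close> defined from it. Bounded quantifiers make
  decidability immediate.\<close>

definition fillable :: "nat \<Rightarrow> nat \<Rightarrow> nat \<Rightarrow> bool" where
  "fillable s l r \<longleftrightarrow> (\<exists>n<2 ^ Suc l. \<exists>y<s. can_fill s l r n y)"

text \<open>\<open>thr s l\<close> is \<open>F k\<close> for the last slot \<open>k < l\<close> occupied at stage \<open>s\<close>, and \<open>0\<close> if there is none.\<close>

definition thr :: "nat \<Rightarrow> nat \<Rightarrow> nat" where
  "thr s l = rec_nat 0 (\<lambda>k r. if fillable s k r then F k else r) l"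

definition occ :: "nat \<Rightarrow> nat \<Rightarrow> bool" where
  "occ s l \<longleftrightarrow> fillable s l (thr s l)"

definition deaths :: "nat \<Rightarrow> nat \<Rightarrow> nat" where
  "deaths s l = (\<Sum>n<2 ^ Suc l. of_bool (2 ^ l \<le> n \<and> dead s n))"

text \<open>Only slots strictly below \<open>l\<close> count, so the quantity belonging to slot
  \<open>l\<close> is \<open>progress s (Suc l)\<close>.\<close>

definition progress :: "nat \<Rightarrow> nat \<Rightarrow> nat" where
  "progress s l = (\<Sum>k<l. of_bool (occ s k) + deaths s k)"

abbreviation wit :: "nat \<Rightarrow> nat \<Rightarrow> nat \<Rightarrow> nat \<Rightarrow> bool" where
  "wit s l n y \<equiv> can_fill s l (thr s l) n y"

lemma occ_iff_wit: "occ s l \<longleftrightarrow> (\<exists>n y. wit s l n y)"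
  unfolding occ_def fillable_def by (auto simp: can_fill_def)

lemma dead_mono: "s \<le> s' \<Longrightarrow> dead s n \<Longrightarrow> dead s' n"
  unfolding dead_def using cov_mono[of s s' n] inA_mono[of s s'] by (meson order_less_le_trans)

lemma thr_0 [simp]: "thr s 0 = 0"
  by (simp add: thr_def)

lemma thr_Suc: "thr s (Suc l) = (if occ s l then F l else thr s l)"
  by (simp add: thr_def occ_def)

lemma thr_cases: "thr s l = 0 \<or> (\<exists>k<l. occ s k \<and> thr s l = F k)"
  by (induction l) (auto simp: thr_Suc less_Suc_eq)

lemma F_le_thr: "occ s k \<Longrightarrow> k < l \<Longrightarrow> F k \<le> thr s l"
  by (induction l) (auto simp: thr_Suc less_Suc_eq intro: F_mono)

lemma thr_eq: "k \<le> l \<Longrightarrow> (\<And>j. k \<le> j \<Longrightarrow> j < l \<Longrightarrow> \<not> occ s j) \<Longrightarrow> thr s l = thr s k"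
proof (induction l)
  case (Suc l)
  then show ?case by (cases "k = Suc l") (auto simp: thr_Suc)
qed simp

lemma thr_le: "(\<And>j. k \<le> j \<Longrightarrow> j < l \<Longrightarrow> \<not> occ s j) \<Longrightarrow> thr s l \<le> F k"
proof -
  assume free: "\<And>j. k \<le> j \<Longrightarrow> j < l \<Longrightarrow> \<not> occ s j"
  from thr_cases[of s l] show ?thesis
  proof
    assume "\<exists>j<l. occ s j \<and> thr s l = F j"
    then obtain j where "j < l" "occ s j" "thr s l = F j" by blast
    with free[of j] F_mono[of j k] show ?thesis by linarith
  qed simp
qed

section \<open>Counting dead programs and bounding the progress\<close>

lemma deaths_eq_card: "deaths s l = card {n. 2 ^ l \<le> n \<and> n < 2 ^ Suc l \<and> dead s n}"
proof -
  have "{..<2 ^ Suc l} \<inter> {n. 2 ^ l \<le> n \<and> dead s n} = {n. 2 ^ l \<le> n \<and> n < 2 ^ Suc l \<and> dead s n}"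
    by auto
  then show ?thesis unfolding deaths_def by (simp only: sum_of_bool_eq finite_lessThan of_nat_id)
qed

lemma deaths_le: "deaths s l \<le> 2 ^ l"
proof -
  have "deaths s l \<le> card {2 ^ l..<2 ^ Suc l :: nat}"
    unfolding deaths_eq_card by (rule card_mono) auto
  then show ?thesis by simp
qed

lemma deaths_mono:
  assumes "s \<le> s'"
  shows "deaths s l \<le> deaths s' l"
  unfolding deaths_eq_card using dead_mono[OF assms] by (intro card_mono) auto

lemma deaths_less:
  assumes "s \<le> s'" "2 ^ l \<le> n" "n < 2 ^ Suc l" "\<not> dead s n" "dead s' n"
  shows "deaths s l < deaths s' l"
  unfolding deaths_eq_card
proof (rule psubset_card_mono)
  show "{n. 2 ^ l \<le> n \<and> n < 2 ^ Suc l \<and> dead s n} \<subset> {n. 2 ^ l \<le> n \<and> n < 2 ^ Suc l \<and> dead s' n}"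
    using assms dead_mono[OF assms(1)] by blast
qed simp

lemma progress_Suc: "progress s (Suc l) = progress s l + of_bool (occ s l) + deaths s l"
  by (simp add: progress_def)

text \<open>Length \<open>k\<close> contributes at most one occupied slot and \<open>2 ^ k\<close>
  deaths. The bound makes the value fit into \<open>l + 2\<close> bits.\<close>

lemma progress_less: "progress s (Suc l) < 2 ^ (l + 2)"
proof -
  have "progress s m < m + 2 ^ m" for m
  proof (induction m)
    case (Suc m)
    moreover have "of_bool (occ s m) \<le> (1::nat)" by simp
    ultimately show ?case using deaths_le[of s m] unfolding progress_Suc by simp
  qed (simp add: progress_def)
  from this[of "Suc l"] have "progress s (Suc l) < Suc l + 2 ^ Suc l" .
  also have "\<dots> < 2 ^ Suc l + 2 ^ Suc l" by (rule add_strict_right_mono) (rule less_exp)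
  also have "\<dots> = 2 ^ (l + 2)" by simp
  finally show ?thesis .
qed

text \<open>A threshold can only rise past \<open>y\<close> because a slot between the previous occupied one and \<open>l\<close>
  has become occupied.\<close>

lemma progress_less_if_thr_rises:
  assumes ss: "s \<le> s'" and mono: "\<And>k. k < l \<Longrightarrow> progress s k \<le> progress s' k"
    and y: "thr s l \<le> y" "y < thr s' l"
  shows "progress s l < progress s' l"
proof -
  obtain k where k: "k < l" "occ s' k" "thr s' l = F k" using thr_cases[of s' l] y by auto
  \<comment> \<open>Otherwise \<open>thr s l\<close> would be at least \<open>F k\<close>, which
    exceeds \<open>y\<close>.\<close>
  have free: "\<not> occ s j" if "k \<le> j" "j < l" for j
    using F_le_thr[of s j l] F_mono[of k j] that y k by linarith
  \<comment> \<open>Slot \<open>k\<close> yields the strict gain; the later slots are empty at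
    \<open>s\<close>, so none of them can lose a unit.\<close>
  have "progress s m < progress s' m" if "Suc k \<le> m" "m \<le> l" for m
    using that
  proof (induction m rule: dec_induct)
    case base
    have "of_bool (occ s k) = (0::nat)" "of_bool (occ s' k) = (1::nat)" using free[of k] k by auto
    then show ?case
      using deaths_mono[OF ss, of k] mono[OF k(1)]
      unfolding progress_Suc by linarith
  next
    case (step m)
    then have "of_bool (occ s m) = (0::nat)" "progress s m < progress s' m" using free[of m] by auto
    then show ?case
      using deaths_mono[OF ss, of m]
      unfolding progress_Suc by linarith
  qed
  with k(1) show ?thesis by simp
qed

text \<open>A lost witness is paid for by a dead program of length \<open>l\<close> or by a new
  occupied slot below \<open>l\<close>.\<close>

lemma wit_lost:
  assumes ss: "s \<le> s'" and mono: "\<And>k. k \<le> l \<Longrightarrow> progress s k \<le> progress s' k"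
    and w: "wit s l n y" "\<not> wit s' l n y"
  shows "progress s (Suc l) < progress s' (Suc l) + of_bool (\<not> occ s' l)"
proof -
  have "occ s l" using w occ_iff_wit by blast
  have "deaths s l < deaths s' l \<or> progress s l < progress s' l"
  proof (cases "dead s' n")
    case True
    then show ?thesis using w deaths_less[OF ss, of l n] unfolding can_fill_def by blast
  next
    case False
    \<comment> \<open>By monotonicity only the threshold clause of \<open>can_fill\<close> can have
      failed.\<close>
    with w cov_mono[OF ss] ss have "thr s l \<le> y" "y < thr s' l"
      unfolding can_fill_def by auto
    then show ?thesis using progress_less_if_thr_rises[OF ss _ , of l y] mono by simp
  qed
  moreover have "deaths s l \<le> deaths s' l" by (rule deaths_mono[OF ss])
  moreover have "progress s l \<le> progress s' l" by (rule mono) simp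
  moreover have "of_bool (occ s l) = (1::nat)" "of_bool (occ s' l) + of_bool (\<not> occ s' l) = (1::nat)"
    using \<open>occ s l\<close> by simp_all
  ultimately show ?thesis unfolding progress_Suc by (elim disjE; linarith)
qed

text \<open>Strong induction on the slot: if the top slot empties, the strict inequality of
  \<open>wit_lost\<close> pays for the lost unit.\<close>

lemma progress_mono:
  assumes "s \<le> s'"
  shows "progress s l \<le> progress s' l"
proof (induction l rule: less_induct)
  case (less l)
  show ?case
  proof (cases l)
    case 0
    then show ?thesis by (simp add: progress_def)
  next
    case l: (Suc k)
    have IH: "progress s j \<le> progress s' j" if "j \<le> k" for j
      by (rule less.IH) (use that l in simp)
    have "progress s (Suc k) \<le> progress s' (Suc k)"
    proof (cases "occ s k \<and> \<not> occ s' k")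
      case True
      then obtain n y where "wit s k n y" "\<not> wit s' k n y"
        using occ_iff_wit[of s k] occ_iff_wit[of s' k] by blast
      with wit_lost[OF assms IH this] True show ?thesis by simp
    next
      case False
      then have "of_bool (occ s k) \<le> (of_bool (occ s' k) :: nat)" by auto
      with IH[of k] deaths_mono[OF assms, of k] show ?thesis
        unfolding progress_Suc by linarith
    qed
    then show ?thesis unfolding l .
  qed
qed

text \<open>A newly filled slot would raise the progress, since the other summands cannot
  shrink.\<close>

lemma occ_stable:
  assumes "s \<le> s'" "progress s (Suc l) = progress s' (Suc l)" "occ s' l"
  shows "occ s l"
proof (rule ccontr)
  assume "\<not> occ s l"
  with assms(2,3) progress_mono[OF assms(1), of l]
    deaths_mono[OF assms(1), of l]
  show False unfolding progress_Suc by simp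
qed

text \<open>The key to decoding: a witness seen when the progress has its final value survives to
  every later stage at which the slot is occupied.\<close>

lemma wit_stable:
  assumes "s \<le> s'" "progress s (Suc l) = progress s' (Suc l)" "occ s' l" "wit s l n y"
  shows "wit s' l n y"
  using wit_lost[OF assms(1) progress_mono[OF assms(1)] assms(4)] assms(2,3) by auto

section \<open>Behaviour of the slots in the limit\<close>

lemma progress_stable: "\<exists>s0. \<forall>s\<ge>s0. progress s (Suc l) = progress s0 (Suc l)"
proof -
  let ?R = "range (\<lambda>s. progress s (Suc l))"
  have fin: "finite ?R"
    by (rule finite_subset[of _ "{..<2 ^ (l + 2)}"]) (use progress_less in auto)
  then have "Max ?R \<in> ?R" by (rule Max_in) auto
  then obtain s0 where "Max ?R = progress s0 (Suc l)" by auto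
  then have "progress s (Suc l) \<le> progress s0 (Suc l)" for s using Max_ge[OF fin] by (metis rangeI)
  then show ?thesis using progress_mono[of s0 _ "Suc l"] by (metis le_antisym)
qed

text \<open>Once the progress is final, a slot that is empty cannot be filled again, by
  \<open>occ_stable\<close>.\<close>

lemma eventually_occ:
  "(\<exists>s0. \<forall>s\<ge>s0. occ s l) \<or> (\<exists>s0. \<forall>s\<ge>s0. \<not> occ s l)"
proof -
  obtain s0 where s0: "\<And>s. s \<ge> s0 \<Longrightarrow> progress s (Suc l) = progress s0 (Suc l)"
    using progress_stable by blast
  show ?thesis
  proof (cases "\<forall>s\<ge>s0. occ s l")
    case False
    then obtain s1 where "s1 \<ge> s0" "\<not> occ s1 l" by blast
    then have "\<forall>s\<ge>s1. \<not> occ s l" using occ_stable[of s1 _ l] s0 by (metis order_trans)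
    then show ?thesis by blast
  qed blast
qed

definition finally_occ :: "nat \<Rightarrow> bool" where
  "finally_occ l \<longleftrightarrow> (\<exists>s0. \<forall>s\<ge>s0. occ s l)"

lemma eventually_free:
  assumes "\<And>k. l \<le> k \<Longrightarrow> k < m \<Longrightarrow> \<not> finally_occ k"
  shows "\<exists>s0. \<forall>s\<ge>s0. \<forall>k. l \<le> k \<and> k < m \<longrightarrow> \<not> occ s k"
  using assms
proof (induction m)
  case (Suc m)
  then obtain s0 where s0: "\<forall>s\<ge>s0. \<forall>k. l \<le> k \<and> k < m \<longrightarrow> \<not> occ s k" by auto
  show ?case
  proof (cases "l \<le> m")
    case True
    then obtain s1 where s1: "\<forall>s\<ge>s1. \<not> occ s m"
      using Suc.prems[of m] eventually_occ[of m] unfolding finally_occ_def by blast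
    have "\<forall>s\<ge>max s0 s1. \<forall>k. l \<le> k \<and> k < Suc m \<longrightarrow> \<not> occ s k"
      using s0 s1 by (auto simp: less_Suc_eq)
    then show ?thesis by blast
  qed (use s0 in \<open>auto simp: less_Suc_eq\<close>)
qed simp

definition sound :: "nat \<Rightarrow> bool" where
  "sound n \<longleftrightarrow> (\<forall>s y. cov s n y \<longrightarrow> \<not> inA s y)"

lemma sound_not_dead: "sound n \<Longrightarrow> \<not> dead s n"
  unfolding sound_def dead_def by blast

lemma occ_if_sound:
  assumes "sound n" "2 ^ l \<le> n" "n < 2 ^ Suc l" "cov s n x" "x < s" "thr s l \<le> x"
  shows "occ s l"
  using assms sound_not_dead unfolding occ_iff_wit can_fill_def by blast

text \<open>Take \<open>x\<close> outside the set and beyond \<open>F L\<close>. A sound program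
  covering it has some length \<open>l\<close> at least \<open>L\<close>. If slots \<open>L\<close>
  to \<open>l\<close> were empty in the limit, the threshold at \<open>l\<close> would be at most
  \<open>F L\<close>, and this program would fill slot \<open>l\<close>.\<close>

lemma infinitely_many_finally_occ:
  assumes inf: "infinite {x. \<forall>s. \<not> inA s x}"
    and covered: "\<And>x. N \<le> x \<Longrightarrow> (\<And>s. \<not> inA s x) \<Longrightarrow> \<exists>n>0. sound n \<and> (\<exists>s. cov s n x)"
  shows "\<exists>l\<ge>L. finally_occ l"
proof (rule ccontr)
  assume no: "\<not> (\<exists>l\<ge>L. finally_occ l)"
  obtain x where x: "max N (F L) \<le> x" "\<And>s. \<not> inA s x"
    using inf unfolding infinite_nat_iff_unbounded_le by blast
  then obtain n s where n: "n > 0" "sound n" "cov s n x" using covered[of x] by auto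
  obtain l where l: "2 ^ l \<le> n" "n < 2 ^ Suc l" using ex_power_ivl1[of 2 n] n(1) by auto
  have "L \<le> l"
  proof (rule ccontr)
    assume "\<not> L \<le> l"
    then have "F l \<le> x" using F_mono[of l L] x(1) by simp
    then show False using F_bound[OF l _ n(3)] n(2) unfolding sound_def by force
  qed
  obtain s0 where s0: "\<forall>s\<ge>s0. \<forall>k. L \<le> k \<and> k < Suc l \<longrightarrow> \<not> occ s k"
    using eventually_free[of L "Suc l"] no by blast
  let ?s = "Max {s, s0, Suc x}"
  have s: "s \<le> ?s" "s0 \<le> ?s" "x < ?s" by auto
  have "thr ?s l \<le> F L" using s0 s(2) by (intro thr_le) auto
  then have "occ ?s l" using occ_if_sound[OF n(2) l cov_mono[OF s(1) n(3)] s(3)] x(1) by simp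
  then show False using s0 s(2) \<open>L \<le> l\<close> by blast
qed

text \<open>If \<open>m\<close> covered \<open>x\<close>, then \<open>x < F k\<close>, so at a late
  stage the slots from \<open>k\<close> to \<open>l - 1\<close> are empty and \<open>k\<close> has
  the threshold of \<open>l\<close>. But then \<open>m\<close> itself would fill slot
  \<open>k\<close>.\<close>

lemma final_witness_hard:
  assumes final: "\<And>s. s0 \<le> s \<Longrightarrow> wit s l n x"
    and m: "sound m" "2 ^ k \<le> m" "m < 2 ^ Suc k" "k < l"
  shows "\<not> cov s m x"
proof
  assume "cov s m x"
  let ?s = "Max {s, s0, Suc x}"
  have s: "s \<le> ?s" "s0 \<le> ?s" "x < ?s" by auto
  have "x < F k" using F_bound[OF m(2,3) _ \<open>cov s m x\<close>] m(1) unfolding sound_def by blast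
  moreover have thr: "thr ?s l \<le> x" using final[OF s(2)] unfolding can_fill_def by blast
  ultimately have free: "\<not> occ ?s j" if "k \<le> j" "j < l" for j
    using that F_le_thr[of ?s j l] F_mono[of k j] by linarith
  then have "thr ?s k \<le> x" using thr_eq[of k l ?s] m(4) thr by simp
  then have "occ ?s k" using occ_if_sound[OF m(1-3) cov_mono[OF s(1) \<open>cov s m x\<close>] s(3)] by simp
  then show False using free[of k] m(4) by simp
qed

text \<open>Otherwise the program \<open>n\<close>, which covers \<open>x\<close>, would be dead at
  a late stage.\<close>

lemma final_witness_outside:
  assumes final: "\<And>s. s0 \<le> s \<Longrightarrow> wit s l n x"
  shows "\<not> inA s x"
proof
  assume "inA s x"
  let ?s = "Max {s, s0, Suc x}"
  have s: "s \<le> ?s" "s0 \<le> ?s" "x < ?s" by auto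
  with final[OF s(2)] inA_mono[OF s(1) \<open>inA s x\<close>] show False
    unfolding can_fill_def dead_def by blast
qed

text \<open>The code \<open>q\<close> stands for the slot \<open>l\<close> together with the final value of the progress up to \<open>l\<close>,
  and \<open>z\<close> for a pair of a stage and a witness. As a binary string \<open>q\<close> has length \<open>l + 2\<close>.\<close>

definition found :: "nat \<Rightarrow> nat \<Rightarrow> bool" where
  "found q z \<longleftrightarrow> (\<exists>l<Suc q. Suc q = 2 ^ (l + 2) + progress (pfst z) (Suc l) \<and>
     (\<exists>n<2 ^ Suc l. wit (pfst z) l n (psnd z)))"

theorem hard_instances_described:
  assumes inf: "infinite {x. \<forall>s. \<not> inA s x}"
    and covered: "\<And>x. N \<le> x \<Longrightarrow> (\<And>s. \<not> inA s x) \<Longrightarrow> \<exists>n>0. sound n \<and> (\<exists>s. cov s n x)"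
  shows "\<exists>l q x. N \<le> x \<and> (\<forall>s. \<not> inA s x) \<and> 2 ^ (l + 2) \<le> Suc q \<and> Suc q < 2 ^ (l + 3) \<and>
    (\<exists>z. found q z) \<and> psnd (LEAST z. found q z) = x \<and>
    (\<forall>k<l. \<forall>m s. sound m \<and> 2 ^ k \<le> m \<and> m < 2 ^ Suc k \<longrightarrow> \<not> cov s m x)"
proof -
  \<comment> \<open>Slot \<open>k\<close> serves to push the witness of slot \<open>l\<close> to at
    least \<open>F k\<close>, hence beyond \<open>N\<close>.\<close>
  obtain k where k: "N \<le> k" "finally_occ k"
    using infinitely_many_finally_occ[OF assms] by blast
  obtain l where l: "k < l" "finally_occ l"
    using infinitely_many_finally_occ[OF assms, where L = "Suc k"] by (auto simp: Suc_le_eq)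
  obtain s0 where s0: "\<And>s. s \<ge> s0 \<Longrightarrow> progress s (Suc l) = progress s0 (Suc l)"
    using progress_stable by blast
  obtain s1 where s1: "\<And>s. s \<ge> s1 \<Longrightarrow> occ s k" using k(2) unfolding finally_occ_def by blast
  obtain s2 where s2: "\<And>s. s \<ge> s2 \<Longrightarrow> occ s l" using l(2) unfolding finally_occ_def by blast
  define v where "v = progress s0 (Suc l)"
  \<comment> \<open>The leading bit of \<open>Suc q\<close> marks the slot, the bits below it hold
    the progress.\<close>
  define q where "q = 2 ^ (l + 2) + v - 1"
  have q: "Suc q = 2 ^ (l + 2) + v" by (simp add: q_def)
  have v: "v < 2 ^ (l + 2)" unfolding v_def by (rule progress_less)
  have found_iff: "found q z \<longleftrightarrow> progress (pfst z) (Suc l) = v \<and> (\<exists>n<2 ^ Suc l. wit (pfst z) l n (psnd z))"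
    for z
  proof
    assume "found q z"
    then obtain j where j: "Suc q = 2 ^ (j + 2) + progress (pfst z) (Suc j)"
      "\<exists>n<2 ^ Suc j. wit (pfst z) j n (psnd z)" unfolding found_def by blast
    have "j + 2 = l + 2"
    proof (rule power_ivl_unique)
      show "2 ^ (j + 2) \<le> Suc q" "Suc q < 2 ^ Suc (j + 2)"
        using j(1) progress_less[of "pfst z" j] by simp_all
      show "2 ^ (l + 2) \<le> Suc q" "Suc q < 2 ^ Suc (l + 2)" using q v by simp_all
    qed
    with j q show "progress (pfst z) (Suc l) = v \<and> (\<exists>n<2 ^ Suc l. wit (pfst z) l n (psnd z))" by simp
  next
    assume "progress (pfst z) (Suc l) = v \<and> (\<exists>n<2 ^ Suc l. wit (pfst z) l n (psnd z))"
    moreover have "l < Suc q" using less_exp[of "l + 2"] q by linarith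
    ultimately show "found q z" unfolding found_def using q by metis
  qed
  let ?s = "Max {s0, s2}"
  obtain n y where "wit ?s l n y" using s2[of ?s] unfolding occ_iff_wit by auto
  then have "found q (prod_encode (?s, y))"
    unfolding found_iff using s0[of ?s] by (auto simp: v_def can_fill_def)
  then have ex: "\<exists>z. found q z" by blast
  \<comment> \<open>The stage of \<open>z\<close> may precede \<open>s0\<close>; what matters is
    that its progress already has the final value, so that \<open>wit_stable\<close>
    applies.\<close>
  define z where "z = (LEAST z. found q z)"
  have "found q z" unfolding z_def using ex by (rule LeastI_ex)
  then obtain n where n: "progress (pfst z) (Suc l) = v" "wit (pfst z) l n (psnd z)"
    unfolding found_iff by blast
  let ?t = "Max {s0, s1, s2, pfst z}"
  have final: "wit s l n (psnd z)" if "?t \<le> s" for s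
    using that n s2 s0[of s] by (intro wit_stable[of "pfst z" s]) (auto simp: v_def)
  have "F k \<le> thr ?t l" using F_le_thr[OF s1 l(1)] by simp
  then have "N \<le> psnd z" using final[of ?t] F_ge[of k] k(1) unfolding can_fill_def by linarith
  moreover have "\<not> inA s (psnd z)" for s by (rule final_witness_outside[OF final])
  moreover have "\<not> cov s m (psnd z)" if "sound m" "2 ^ j \<le> m" "m < 2 ^ Suc j" "j < l" for s m j
    by (rule final_witness_hard[OF final that])
  moreover have "2 ^ (l + 2) \<le> Suc q" "Suc q < 2 ^ (l + 3)" using q v by (simp_all add: eval_nat_numeral)
  ultimately show ?thesis using ex unfolding z_def by blast
qed

lemma found_decidable:
  assumes cov: "\<And>f g h. total_recursive f \<Longrightarrow> total_recursive g \<Longrightarrow> total_recursive h \<Longrightarrow>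
      decidable (\<lambda>x. cov (f x) (g x) (h x))"
    and inA: "\<And>f g. total_recursive f \<Longrightarrow> total_recursive g \<Longrightarrow> decidable (\<lambda>x. inA (f x) (g x))"
    and F: "\<And>f. total_recursive f \<Longrightarrow> total_recursive (\<lambda>x. F (f x))"
  shows "decidable (\<lambda>y. found (pfst y) (psnd y))"
proof -
  have can_fill: "decidable (\<lambda>x. can_fill (a x) (b x) (c x) (d x) (e x))"
    if "total_recursive a" "total_recursive b" "total_recursive c" "total_recursive d"
      "total_recursive e" for a b c d e
    unfolding can_fill_def dead_def
    by (intro recursive_intros that cov inA total_recursive_comp[OF that(1)]
        total_recursive_comp[OF that(4)])
  have fillable: "decidable (\<lambda>x. fillable (a x) (b x) (c x))"
    if "total_recursive a" "total_recursive b" "total_recursive c" for a b c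
    unfolding fillable_def
    by (intro recursive_intros can_fill that total_recursive_comp[OF that(1)]
        total_recursive_comp[OF that(2)] total_recursive_comp[OF that(3)])
  have thr: "total_recursive (\<lambda>x. thr (a x) (b x))"
    if "total_recursive a" "total_recursive b" for a b
    unfolding thr_def
    by (intro recursive_intros fillable F that total_recursive_comp[OF that(1)])
  have occ: "decidable (\<lambda>x. occ (a x) (b x))"
    if "total_recursive a" "total_recursive b" for a b
    unfolding occ_def by (intro fillable thr that)
  have deaths: "total_recursive (\<lambda>x. deaths (a x) (b x))"
    if "total_recursive a" "total_recursive b" for a b
    unfolding deaths_def dead_def
    by (intro recursive_intros cov inA that total_recursive_comp[OF that(1)]
        total_recursive_comp[OF that(2)])
  have progress: "total_recursive (\<lambda>x. progress (a x) (b x))"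
    if "total_recursive a" "total_recursive b" for a b
    unfolding progress_def
    by (intro recursive_intros occ deaths that total_recursive_comp[OF that(1)])
  show ?thesis
    unfolding found_def by (intro recursive_intros progress can_fill thr)
qed

end


section \<open>Hard instances\<close>

lemma length_bounds: "2 ^ length w \<le> Suc (nat_of_str w) \<and> Suc (nat_of_str w) < 2 ^ Suc (length w)"
  by (induction w rule: rev_induct) auto

lemma nat_of_answer_eq_iff: "nat_of_answer a = nat_of_answer b \<longleftrightarrow> a = b"
  using bij_nat_of_str by (cases a; cases b) (auto simp: bij_def inj_eq)

lemma ic_bar_le_ic: "ic_bar V x A \<le> ic V x A"
  unfolding ic_bar_def ic_def by (rule Inf_superset_mono) blast

text \<open>The program for the section at \<open>q\<close> feeds the
  constant \<open>q\<close>, written as an iterated successor, into the first component.\<close>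

lemma re_sections_index:
  assumes "partial_recursive g"
  shows "\<exists>e. total_recursive e \<and> (\<forall>q. W (e q) = {z. g (prod_encode (q, z)) \<noteq> None})"
proof -
  obtain p where p: "g = eval p" using assms unfolding partial_recursive_def by blast
  define const where "const q = rec_nat Zero (\<lambda>_ r. Comp Succ r) q" for q
  define i where "i = goedel (Pairing Fst Snd)"
  \<comment> \<open>\<open>c\<close> mirrors \<open>goedel\<close> along \<open>const\<close>: 1
    codes \<open>Succ\<close>, and \<open>4 * _ + 5\<close> codes \<open>Comp\<close>.\<close>
  define c where "c q = rec_nat 0 (\<lambda>_ r. 4 * prod_encode (1, r) + 5) q" for q :: nat
  define e where "e q = 4 * prod_encode (goedel p, 4 * prod_encode (c q, i) + 4) + 5" for q
  have const: "eval (const q) z = Some q" for q z by (induction q) (simp_all add: const_def)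
  have "goedel (const q) = c q" for q by (induction q) (simp_all add: const_def c_def)
  then have "goedel (Comp p (Pairing (const q) (Pairing Fst Snd))) = e q" for q
    by (simp add: e_def i_def)
  then have "\<phi> (e q) = eval (Comp p (Pairing (const q) (Pairing Fst Snd)))" for q
    unfolding \<phi>_def by (metis inj_goedel inv_f_f)
  then have "\<phi> (e q) z = g (prod_encode (q, z))" for q z by (simp add: const p)
  then have "W (e q) = {z. g (prod_encode (q, z)) \<noteq> None}" for q unfolding W_def dom_def by simp
  moreover have "total_recursive e"
    unfolding e_def c_def by (intro recursive_intros)
  ultimately show ?thesis by blast
qed

text \<open>Since \<open>2 = Suc (nat_of_str [False])\<close>, a value \<open>2\<close> of the number function for \<open>V\<close> is the
  answer \<open>0\<close>, and \<^const>\<open>steps\<close> reports it as \<open>3\<close>.\<close>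

lemma answer_zero_iff:
  assumes "\<And>p z. map_option nat_of_answer (V p z) = eval u (prod_encode (nat_of_str p, nat_of_str z))"
  shows "V p z = Some (Str [False]) \<longleftrightarrow>
    (\<exists>s. steps u s (prod_encode (nat_of_str p, nat_of_str z)) = 3)"
proof -
  have two: "nat_of_answer (Str [False]) = 2" using nat_of_str_snoc[of "[]" False] by simp
  have "V p z = Some (Str [False]) \<longleftrightarrow> map_option nat_of_answer (V p z) = Some 2"
    unfolding two[symmetric] by (cases "V p z") (simp_all only: option.map option.simps nat_of_answer_eq_iff)
  then show ?thesis unfolding assms eval_eq_Some_iff by (simp add: eval_nat_numeral)
qed

theorem corollary4p5:
  fixes U :: mapping and A :: "str set"
  assumes "optimal U"
    and "strongly_effectively_simple (nat_of_str ` A)"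
  shows "(\<exists>c::nat. infinite {x. ic U x A \<ge> kolm U x - enat c}) \<and>
         (\<exists>c'::nat. infinite {x. ic_bar U x A \<ge> kolm U x - enat c'})"
proof -
  let ?A = "nat_of_str ` A"
  let ?str = "inv nat_of_str"
  have str [simp]: "?str (nat_of_str w) = w" "nat_of_str (?str x) = x" for w x
    using bij_nat_of_str by (simp_all add: bij_def surj_f_inv_f)
  have str_in_A: "?str x \<in> A \<longleftrightarrow> x \<in> ?A" for x by (metis str imageE imageI)
  obtain a where a: "?A = dom (eval a)"
    using assms(2) unfolding strongly_effectively_simple_def re_set_def partial_recursive_def by auto
  obtain f where f: "total_recursive f" "\<And>e y. W e \<subseteq> - ?A \<Longrightarrow> y \<in> W e \<Longrightarrow> y < f e"
    using assms(2) unfolding strongly_effectively_simple_def by blast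
  have coinf: "infinite (- ?A)" using assms(2) unfolding strongly_effectively_simple_def by blast
  obtain u where u: "map_option nat_of_answer (U p z) =
      eval u (prod_encode (nat_of_str p, nat_of_str z))" for p z
    using assms(1) unfolding optimal_def partial_recursive_mapping_def partial_recursive_def by metis

  \<comment> \<open>The search condition does not mention \<open>n\<close>, so the search acts as a
    filter: \<open>g\<close> is defined exactly where the value of \<open>u\<close> is 2, the code
    of the answer 0.\<close>
  define g where "g x = Option.bind (eval u x)
      (\<lambda>v. if \<exists>n::nat. v = 2 then Some (LEAST n::nat. v = 2) else None)" for x
  have "decidable (\<lambda>y. pfst y = 2)" by (intro recursive_intros)
  from partial_recursive_comp[OF partial_recursive_Least[OF this], of "eval u"]
  have "partial_recursive g" unfolding g_def partial_recursive_def by blast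
  then obtain e where e: "total_recursive e" "\<And>q. W (e q) = {z. g (prod_encode (q, z)) \<noteq> None}"
    using re_sections_index by blast
  have W_e: "z \<in> W (e q) \<longleftrightarrow> (\<exists>s. steps u s (prod_encode (q, z)) = 3)" for q z
  proof -
    have "z \<in> W (e q) \<longleftrightarrow> eval u (prod_encode (q, z)) = Some 2"
      unfolding e(2) g_def by (auto simp: bind_eq_None_conv split: if_splits)
    then show ?thesis unfolding eval_eq_Some_iff by (simp add: eval_nat_numeral)
  qed

  define inA where "inA s x \<longleftrightarrow> 0 < steps a s x" for s x
  define cov where "cov s n x \<longleftrightarrow> steps u s (prod_encode (n - 1, x)) = 3" for s n x
  \<comment> \<open>A sum serves as a recursive upper bound for all programs of length at most
    \<open>l\<close>; it is monotone, and the summand \<open>l\<close> gives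
    \<open>F_ge\<close>.\<close>
  define F where "F l = l + (\<Sum>n<2 ^ Suc l. f (e (n - 1)))" for l
  have in_A: "x \<in> ?A \<longleftrightarrow> (\<exists>s. inA s x)" for x
  proof -
    have "x \<in> ?A \<longleftrightarrow> (\<exists>y. eval a x = Some y)" unfolding a by blast
    then show ?thesis unfolding eval_eq_Some_iff inA_def gr0_conv_Suc by blast
  qed
  have cov_iff: "(\<exists>s. cov s (Suc (nat_of_str p)) x) \<longleftrightarrow> U p (?str x) = Some (Str [False])" for p x
    using answer_zero_iff[OF u, of p "?str x"] by (simp add: cov_def)

  interpret cover_race cov inA F
  proof
    show "cov s' n x" if "s \<le> s'" "cov s n x" for s s' n x
      using that steps_mono[of u s _ 2 s'] unfolding cov_def by (simp add: eval_nat_numeral)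
    show "inA s' x" if "s \<le> s'" "inA s x" for s s' x
      using that steps_mono[of a s x _ s'] unfolding inA_def gr0_conv_Suc by blast
    show "F k \<le> F l" if "k \<le> l" for k l
    proof -
      have "(2::nat) ^ Suc k \<le> 2 ^ Suc l" using that by (intro power_increasing) auto
      then show ?thesis unfolding F_def using that by (intro add_mono sum_mono2) auto
    qed
    show "l \<le> F l" for l by (simp add: F_def)
    show "x < F l" if n: "2 ^ l \<le> n" "n < 2 ^ Suc l" and sound: "\<And>s y. cov s n y \<Longrightarrow> \<not> inA s y"
      and x: "cov s n x" for l n s x
    proof -
      have "y \<notin> ?A" if "y \<in> W (e (n - 1))" for y
      proof
        assume "y \<in> ?A"
        then obtain t where t: "inA t y" using in_A by blast
        obtain r where r: "cov r n y" using \<open>y \<in> W (e (n - 1))\<close> unfolding W_e cov_def by blast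
        \<comment> \<open>The two events may be seen at different stages, while the hypothesis
          speaks of a common one.\<close>
        have "cov (max r t) n y"
          using r steps_mono[of u r _ 2 "max r t"] unfolding cov_def by (simp add: eval_nat_numeral)
        moreover have "inA (max r t) y"
          using t steps_mono[of a t y _ "max r t"] unfolding inA_def gr0_conv_Suc
          by (meson max.cobounded2)
        ultimately show False using sound by blast
      qed
      moreover have "x \<in> W (e (n - 1))" using x unfolding W_e cov_def by blast
      ultimately have "x < f (e (n - 1))" by (intro f(2)) auto
      also have "\<dots> \<le> (\<Sum>n<2 ^ Suc l. f (e (n - 1)))"
        by (rule member_le_sum[where f = "\<lambda>n. f (e (n - 1))"]) (use n in auto)
      finally show ?thesis unfolding F_def by simp
    qed
  qed

  have sound: "sound (Suc (nat_of_str p))" if "consistent A (U p)" for p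
    unfolding sound_def
  proof (intro allI impI notI)
    fix s y
    assume "cov s (Suc (nat_of_str p)) y" "inA s y"
    then have "U p (?str y) = Some (Str [False])" "?str y \<in> A"
      using cov_iff in_A str_in_A by blast+
    with that show False unfolding consistent_def chi_def by force
  qed

  have "decidable (\<lambda>y. found (pfst y) (psnd y))"
  proof (rule found_decidable)
    show "decidable (\<lambda>x. cov (g x) (h x) (k x))"
      if "total_recursive g" "total_recursive h" "total_recursive k" for g h k
      unfolding cov_def by (intro recursive_intros total_recursive_steps that)
    show "decidable (\<lambda>x. inA (g x) (h x))"
      if "total_recursive g" "total_recursive h" for g h
      unfolding inA_def by (intro recursive_intros total_recursive_steps that)
    show "total_recursive (\<lambda>x. F (g x))" if "total_recursive g" for g
      unfolding F_def
      by (intro recursive_intros that total_recursive_comp[OF f(1)] total_recursive_comp[OF e(1)])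
  qed
  \<comment> \<open>The search receives the pair of both string codes, so \<open>q\<close> lies one
    projection deeper.\<close>
  then have "decidable (\<lambda>y. found (pfst (pfst y)) (psnd y))"
    by (rule total_recursive_comp2) (intro recursive_intros)+
  note search = partial_recursive_Least[OF this]
  \<comment> \<open>\<open>Suc\<close> because \<open>nat_of_answer\<close> reserves 0 for
    \<open>Bot\<close>.\<close>
  have "partial_recursive (\<lambda>z. Some (Suc (psnd z)))"
    using total_recursive_Suc[OF total_recursive_psnd[OF total_recursive_id]]
    unfolding total_recursive_def .
  note decoder = partial_recursive_comp[OF this search]
  define h where "h x = Option.bind (if \<exists>z. found (pfst x) z then Some (LEAST z. found (pfst x) z) else None)
    (\<lambda>z. Some (Suc (psnd z)))" for x
  have h: "partial_recursive h" using decoder unfolding h_def .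
  define answer_of where "answer_of n = (if n = 0 then Bot else Str (?str (n - 1)))" for n
  have answer_of: "nat_of_answer (answer_of n) = n" for n by (simp add: answer_of_def)
  define V :: mapping where
    "V p z = map_option answer_of (h (prod_encode (nat_of_str p, nat_of_str z)))" for p z
  have "partial_recursive_mapping V"
    unfolding partial_recursive_mapping_def V_def option.map_comp
    using h by (intro exI[of _ h]) (simp add: comp_def answer_of option.map_ident)
  then obtain d where d: "\<And>x. kolm U x \<le> kolm V x + enat d"
    using assms(1) unfolding optimal_def by blast

  \<comment> \<open>Descriptions have length \<open>l + 2\<close>, against instance complexity at
    least \<open>l\<close>; \<open>d\<close> comes from optimality.\<close>
  let ?S = "{x. ic_bar U x A \<ge> kolm U x - enat (d + 2)}"
  have "infinite ?S"
  proof
    assume "finite ?S"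
    then obtain N where N: "\<And>w. w \<in> ?S \<Longrightarrow> nat_of_str w < N"
      using finite_nat_set_iff_bounded[of "nat_of_str ` ?S"] by blast
    have covered: "\<exists>n>0. sound n \<and> (\<exists>s. cov s n x)" if x: "N \<le> x" "\<And>s. \<not> inA s x" for x
    proof -
      have "?str x \<notin> ?S" using N[of "?str x"] x(1) by auto
      \<comment> \<open>An infinite value would put the string into \<open>?S\<close>.\<close>
      then have fin: "ic_bar U (?str x) A \<noteq> \<infinity>" by force
      have "\<exists>p. consistent A (U p) \<and> U p (?str x) = Some (chi A (?str x))"
      proof (rule ccontr)
        assume "\<not> ?thesis"
        then have "ic_bar U (?str x) A = Inf {}" unfolding ic_bar_def by (intro arg_cong[of _ _ Inf]) auto
        with fin show False by (simp add: Inf_enat_def)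
      qed
      then obtain p where p: "consistent A (U p)" "U p (?str x) = Some (chi A (?str x))" by blast
      have "?str x \<notin> A" using x(2) in_A str_in_A by blast
      with p(2) have "\<exists>s. cov s (Suc (nat_of_str p)) x" unfolding cov_iff chi_def by simp
      with sound[OF p(1)] show ?thesis by blast
    qed
    have "{x. \<forall>s. \<not> inA s x} = - ?A" using in_A by blast
    with coinf have "infinite {x. \<forall>s. \<not> inA s x}" by simp
    from hard_instances_described[OF this covered] obtain l q x where x: "N \<le> x" "\<forall>s. \<not> inA s x"
      and q: "2 ^ (l + 2) \<le> Suc q" "Suc q < 2 ^ (l + 3)"
      and found: "\<exists>z. found q z" "psnd (LEAST z. found q z) = x"
      and hard: "\<And>k m s. k < l \<Longrightarrow> sound m \<Longrightarrow> 2 ^ k \<le> m \<Longrightarrow> m < 2 ^ Suc k \<Longrightarrow> \<not> cov s m x"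
      by blast
    have "?str x \<notin> A" using x(2) in_A str_in_A by blast
    have "enat l \<le> ic_bar U (?str x) A"
      unfolding ic_bar_def
    proof (rule Inf_greatest, clarify)
      fix p
      assume p: "consistent A (U p)" "U p (?str x) = Some (chi A (?str x))"
      obtain s where "cov s (Suc (nat_of_str p)) x"
        using p(2) \<open>?str x \<notin> A\<close> cov_iff[of p x] by (auto simp: chi_def)
      then have "\<not> length p < l"
        using hard[OF _ sound[OF p(1)], of "length p"] length_bounds[of p] by blast
      then show "enat l \<le> enat (length p)" by simp
    qed
    moreover have "kolm U (?str x) \<le> enat (l + 2 + d)"
    proof -
      have "length (?str q) = l + 2"
        by (rule power_ivl_unique[where n = "Suc q"])
          (use length_bounds[of "?str q"] q in \<open>simp_all add: eval_nat_numeral\<close>)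
      moreover have "V (?str q) [] = Some (Str (?str x))"
        using found by (simp add: V_def h_def answer_of_def)
      ultimately have "kolm V (?str x) \<le> enat (l + 2)"
        unfolding kolm_def by (intro Inf_lower) force
      then have "kolm V (?str x) + enat d \<le> enat (l + 2) + enat d" by (rule add_right_mono)
      with d[of "?str x"] show ?thesis by (metis order_trans plus_enat_simps(1))
    qed
    ultimately have "?str x \<in> ?S" by (cases "kolm U (?str x)"; cases "ic_bar U (?str x) A") auto
    then show False using N[of "?str x"] x(1) by simp
  qed
  \<comment> \<open>As \<open>ic\<close> is at least \<open>ic_bar\<close>, the claim for
    \<open>ic\<close> follows with the same constant.\<close>
  moreover have "?S \<subseteq> {x. ic U x A \<ge> kolm U x - enat (d + 2)}"
    using ic_bar_le_ic order_trans by blast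
  ultimately show ?thesis using infinite_super by blast
qed

end
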